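(* Let a random process $X=\{X(t),t\in B\}$ belong to $Sub_\varphi(\Omega)$, where $(B,\rho)$ is a separable compact set and $X$ is separable on $(B,\rho)$. Let $\varphi(t)=\frac{t^\zeta}{\zeta}$ for $t>1$, where $\zeta\ge2$. Let there exist a continuous monotonically increasing function $\sigma=\{\sigma(h),h>0\}$ with $\sigma(h)\to0$ as $h\to0$ and $$\sup_{\rho(t,s)\le h}\tau_\varphi(X(t)-X(s))\le\sigma(h).$$ Let $\beta=\sigma\big(\inf_{s\in B}\sup_{t\in B}\rho(t,s)\big)>0$, and let $N_B(u)$ be the minimal number of closed balls of radius $u$ that cover $(B,\rho)$. Let $r_1=\{r_1(u):u\ge1\}$ be a continuous function such that $r_1(u)>0$ for $u>1$ and the function $s(t)=r_1(\exp\{t\})$, $t>0$, is convex, and let $$\int_0^\beta r_1\big(N_B(\sigma^{(-1)}(u))\big)\,du<\infty.$$ Then the process $X(t)$ is bounded with probability one, and for all $p\in(0,1)$ the inequalities $$P\Big\{\sup_{t\in B}X(t)>x\Big\}\le Z_{r_1}(p,\beta,x),\qquad P\Big\{\inf_{t\in B}X(t)<-x\Big\}\le Z_{r_1}(p,\beta,x),\qquad P\Big\{\sup_{t\in B}|X(t)|>x\Big\}\le2Z_{r_1}(p,\beta,x)$$ hold, where $$Z_{r_1}(p,\beta,x)=\exp\left\{\frac{(1-\zeta)(x(1-p))^{\frac{\zeta}{\zeta-1}}}{\zeta\big(\gamma^\zeta(1-p)+p\beta^\zeta\big)^{\frac1{\zeta-1}}}\right\}r_1^{(-1)}\left(\frac1{\beta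 p}\int_0^{\beta p}r_1\big(N_B(\sigma^{(-1)}(u))\big)\,du\right),$$ $$x>\frac{\gamma^\zeta(1-p)+p\beta^\zeta}{(1-p)v^{\zeta-1}},\qquad v=\min\{\beta,\gamma\},\qquad\gamma^\zeta=\sup_{u\in B}\tau_\varphi^\zeta(X(u)).$$
   Context: $\varphi$ is an $N$-function satisfying condition Q. An $N$-function is a continuous even convex function on $\mathbb R$, monotonically increasing for $x>0$, with $\varphi(0)=0$, $\varphi(x)/x\to0$ as $x\to0$ and $\varphi(x)/x\to\infty$ as $x\to\infty$. Condition Q: $\liminf_{x\to0}\varphi(x)/x^2=C>0$ (possibly $C=+\infty$). A random variable $\xi$ belongs to $Sub_\varphi(\Omega)$ if $E\xi=0$, $E\exp\{\lambda\xi\}$ exists for all $\lambda\in\mathbb R$, and there is $a>0$ with $E\exp\{\lambda\xi\}\le\exp\{\varphi(\lambda a)\}$ for all $\lambda\in\mathbb R$; $Sub_\varphi(\Omega)$ is a Banach space with norm $\tau_\varphi(\xi)=\inf\{a\ge0:E\exp\{\lambda\xi\}\le\exp\{\varphi(\lambda a)\},\ \lambda\in\mathbb R\}$. A process belongs to $Sub_\varphi(\Omega)$ if each of its values does. $\sigma^{(-1)}$ and $r_1^{(-1)}$ denote the inverse functions of $\sigma$ and $r_1$.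
   Formalization: The function r_1 is additionally assumed strictly increasing on [1,∞); the statement only implies it is invertible, and for a decreasing choice such as r_1(u)=1/u the integral is always finite and the boundedness claim fails. *)

theory Defs
  imports "HOL-Probability.Probability"
begin

definition N_function :: "(real \<Rightarrow> real) \<Rightarrow> bool" where
  "N_function \<phi> \<longleftrightarrow>
     continuous_on UNIV \<phi> \<and> (\<forall>x. \<phi> (- x) = \<phi> x) \<and> convex_on UNIV \<phi> \<and>
     strict_mono_on {0<..} \<phi> \<and> \<phi> 0 = 0 \<and>
     ((\<lambda>x. \<phi> x / x) \<longlongrightarrow> 0) (at 0) \<and>
     filterlim (\<lambda>x. \<phi> x / x) at_top at_top"

definition condition_Q :: "(real \<Rightarrow> real) \<Rightarrow> bool" where
  "condition_Q \<phi> \<longleftrightarrow> Liminf (at 0) (\<lambda>x. ereal (\<phi> x / x\<^sup>2)) > 0"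

definition Sub_phi :: "'w measure \<Rightarrow> (real \<Rightarrow> real) \<Rightarrow> ('w \<Rightarrow> real) set" where
  "Sub_phi M \<phi> = {\<xi> \<in> borel_measurable M.
     integrable M \<xi> \<and> (\<integral>\<omega>. \<xi> \<omega> \<partial>M) = 0 \<and>
     (\<forall>l. integrable M (\<lambda>\<omega>. exp (l * \<xi> \<omega>))) \<and>
     (\<exists>a>0. \<forall>l. (\<integral>\<omega>. exp (l * \<xi> \<omega>) \<partial>M) \<le> exp (\<phi> (l * a)))}"

definition tau_phi :: "'w measure \<Rightarrow> (real \<Rightarrow> real) \<Rightarrow> ('w \<Rightarrow> real) \<Rightarrow> real" where
  "tau_phi M \<phi> \<xi> =
     Inf {a. 0 \<le> a \<and> (\<forall>l. (\<integral>\<omega>. exp (l * \<xi> \<omega>) \<partial>M) \<le> exp (\<phi> (l * a)))}"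

text \<open>Separability of a process relative to closed sets: one countable dense set \<open>S\<close> and one null
  set \<open>N\<close> serve all open \<open>G\<close> and all closed \<open>F\<close> simultaneously. The reverse inclusion of the two
  events is trivial.\<close>

definition separable_process ::
    "'w measure \<Rightarrow> 'b set \<Rightarrow> ('b \<Rightarrow> 'b \<Rightarrow> real) \<Rightarrow> ('b \<Rightarrow> 'w \<Rightarrow> real) \<Rightarrow> bool" where
  "separable_process M B \<rho> X \<longleftrightarrow>
     (\<exists>S N. countable S \<and> S \<subseteq> B \<and> Metric_space.mtopology B \<rho> closure_of S = B \<and>
        N \<in> null_sets M \<and>
        (\<forall>G F. openin (Metric_space.mtopology B \<rho>) G \<longrightarrow> closed F \<longrightarrow>
           {\<omega> \<in> space M. \<forall>t \<in> G \<inter> S. X t \<omega> \<in> F} -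
           {\<omega> \<in> space M. \<forall>t \<in> G. X t \<omega> \<in> F} \<subseteq> N))"

text \<open>The centres of the covering balls lie in \<open>B\<close>.\<close>

definition covering_number :: "'b set \<Rightarrow> ('b \<Rightarrow> 'b \<Rightarrow> real) \<Rightarrow> real \<Rightarrow> nat" where
  "covering_number B \<rho> u =
     (LEAST n. \<exists>C. C \<subseteq> B \<and> finite C \<and> card C = n \<and>
        B \<subseteq> (\<Union>c\<in>C. Metric_space.mcball B \<rho> c u))"

definition entropy_integrand ::
    "'b set \<Rightarrow> ('b \<Rightarrow> 'b \<Rightarrow> real) \<Rightarrow> (real \<Rightarrow> real) \<Rightarrow> (real \<Rightarrow> real) \<Rightarrow> real \<Rightarrow> real" where
  "entropy_integrand B \<rho> \<sigma> r1 u =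
     r1 (real (covering_number B \<rho> (the_inv_into {0<..} \<sigma> u)))"

definition Z_bound ::
    "'b set \<Rightarrow> ('b \<Rightarrow> 'b \<Rightarrow> real) \<Rightarrow> (real \<Rightarrow> real) \<Rightarrow> (real \<Rightarrow> real) \<Rightarrow>
     real \<Rightarrow> real \<Rightarrow> real \<Rightarrow> real \<Rightarrow> real \<Rightarrow> real" where
  "Z_bound B \<rho> \<sigma> r1 \<zeta> \<gamma> p \<beta> x =
     exp (((1 - \<zeta>) * (x * (1 - p)) powr (\<zeta> / (\<zeta> - 1))) /
          (\<zeta> * (\<gamma> powr \<zeta> * (1 - p) + p * \<beta> powr \<zeta>) powr (1 / (\<zeta> - 1)))) *
     the_inv_into {1..} r1
       (1 / (\<beta> * p) * (LBINT u:{0<..<\<beta> * p}. entropy_integrand B \<rho> \<sigma> r1 u))"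

end

theory Submission
  imports Defs
begin

text \<open>The proof is entropy chaining with weights that are tuned to \<open>p\<close>. Put \<open>w j = (1 - p) * p ^ j\<close>,
so that the weights sum to 1, and choose for every \<open>j\<close> a minimal net of \<open>B\<close> of radius
\<open>\<sigma>\<^sup>-\<^sup>1 (\<beta> * p ^ Suc j)\<close>. A point \<open>t\<close> is reached along a chain of net points, and
\<open>X t\<close> is the value of the process at the coarsest one plus the increments along the chain. The value
has norm at most \<open>\<gamma>\<close>, an increment arriving at level \<open>j\<close> has norm at most \<open>\<beta> * p ^ j\<close>. After
division by the weight \<open>w j\<close> all increments therefore meet the same bound \<open>\<phi> (l * \<beta> / (1 - p))\<close>
on the logarithm of the moment generating function, whatever the level.\<close>

text \<open>The levels are not independent, and convexity of \<open>exp\<close> takes the place of independence: a weighted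
geometric mean of normalised sums of exponentials is at most the weighted arithmetic mean, whose
expectation is at most 1 (\<open>chaining_tail\<close>). This costs a factor \<open>N\<close> to the power \<open>w j\<close> for a
level with \<open>N\<close> points, so the cost of the whole chain is the exponential of the mean of \<open>ln N\<close> under
the weights. By Jensen's inequality for the convex function \<open>r1 \<circ> exp\<close>, and because
\<open>\<beta> * p * w j\<close> is the length of the interval between \<open>\<beta> * p ^ Suc (Suc j)\<close> and
\<open>\<beta> * p ^ Suc j\<close>, on which the decreasing entropy integrand is at least its value at the right end,
this mean is controlled by the entropy integral over \<open>{0<..<\<beta> * p}\<close> (\<open>entropy_factor\<close>).\<close>

text \<open>Only finite sets of points have to be reached. A chain of depth \<open>K\<close> may end in an arbitrary finite
set \<open>T\<close>, at the price of the factor \<open>card T\<close> to the power \<open>w K\<close>, and this factor tends to 1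
(\<open>geometric_chaining_tail\<close>). Continuity of the measure extends the estimate to countable sets, and
separability to \<open>B\<close>. What remains is a tail bound with a free parameter \<open>l > 0\<close>; for
\<open>\<gamma> > 0\<close> the threshold for \<open>x\<close> says precisely that at the minimising \<open>l\<close> both arguments of \<open>\<phi>\<close> exceed 1, where
\<open>\<phi>\<close> is the power function (\<open>power_exponent_optimum\<close>). The infimum is the supremum of \<open>- X\<close>,
which satisfies the same hypotheses.\<close>

section \<open>A discrete Jensen inequality\<close>

text \<open>Jensen's inequality for weights of total mass at most 1: the missing mass is placed at the origin. A
chain of finite depth uses only part of the weights \<open>(1 - p) * p ^ j\<close>, and the two functions to which
this is applied, \<open>exp\<close> and \<open>r1 \<circ> exp\<close>, are known at 0.\<close>

lemma convex_on_subprob_sum: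
  fixes f u :: "_ \<Rightarrow> real" and w :: "nat \<Rightarrow> real"
  assumes "convex_on C f" "0 \<in> C"
    and w: "\<And>j. j < n \<Longrightarrow> 0 \<le> w j" "(\<Sum>j<n. w j) \<le> 1"
    and u: "\<And>j. j < n \<Longrightarrow> u j \<in> C"
  shows "f (\<Sum>j<n. w j * u j) \<le> (1 - (\<Sum>j<n. w j)) * f 0 + (\<Sum>j<n. w j * f (u j))"
proof -
  let ?w = "\<lambda>j. if j < n then w j else 1 - (\<Sum>j<n. w j)"
  let ?u = "\<lambda>j. if j < n then u j else 0"
  have "f (\<Sum>j<Suc n. ?w j *\<^sub>R ?u j) \<le> (\<Sum>j<Suc n. ?w j * f (?u j))"
    by (rule convex_on_sum[OF _ _ assms(1)]) (use w u assms(2) in \<open>auto\<close>)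
  then show ?thesis by simp
qed

section \<open>Exponential moment bounds\<close>

text \<open>For \<open>a \<ge> 0\<close> this says that \<open>a\<close> is admissible in the infimum that defines the norm of
\<open>\<xi>\<close>. Chaining manipulates admissible numbers, which are stable under the operations below, instead of the norm.\<close>

definition mgf_bound :: "'w measure \<Rightarrow> (real \<Rightarrow> real) \<Rightarrow> real \<Rightarrow> ('w \<Rightarrow> real) \<Rightarrow> bool" where
  "mgf_bound M \<phi> a \<xi> \<longleftrightarrow> \<xi> \<in> borel_measurable M \<and>
     (\<forall>l. integrable M (\<lambda>\<omega>. exp (l * \<xi> \<omega>)) \<and>
          (\<integral>\<omega>. exp (l * \<xi> \<omega>) \<partial>M) \<le> exp (\<phi> (l * a)))"

lemma N_function_nonneg:
  assumes "N_function \<phi>" shows "0 \<le> \<phi> x"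
proof -
  have "convex_on UNIV \<phi>" "\<phi> (-x) = \<phi> x" "\<phi> 0 = 0"
    using assms by (auto simp: N_function_def)
  then show ?thesis
    using convex_onD[of UNIV \<phi> "1/2" x "-x"] by simp
qed

lemma N_function_mono:
  assumes N: "N_function \<phi>" and "\<bar>x\<bar> \<le> \<bar>y\<bar>" shows "\<phi> x \<le> \<phi> y"
proof -
  have ev: "\<phi> \<bar>z\<bar> = \<phi> z" for z
    using N by (cases "z \<ge> 0") (auto simp: N_function_def)
  have sm: "strict_mono_on {0<..} \<phi>" and z: "\<phi> 0 = 0"
    using N by (auto simp: N_function_def)
  have "\<phi> \<bar>x\<bar> \<le> \<phi> \<bar>y\<bar>"
  proof (cases "x = 0")
    case True then show ?thesis using N_function_nonneg[OF N] z by simp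
  next
    case False
    then show ?thesis
      using assms(2) strict_mono_onD[OF sm, of "\<bar>x\<bar>" "\<bar>y\<bar>"]
      by (cases "\<bar>x\<bar> = \<bar>y\<bar>") (force simp: less_imp_le)+
  qed
  then show ?thesis by (simp add: ev)
qed

lemma mgf_bound_mono:
  assumes "N_function \<phi>" "mgf_bound M \<phi> a \<xi>" "0 \<le> a" "a \<le> b"
  shows "mgf_bound M \<phi> b \<xi>"
proof -
  have "\<phi> (l * a) \<le> \<phi> (l * b)" for l
    by (rule N_function_mono[OF assms(1)]) (use assms in \<open>simp add: abs_mult mult_left_mono\<close>)
  then show ?thesis
    using assms(2) unfolding mgf_bound_def by (meson exp_le_cancel_iff order_trans)
qed

lemma mgf_bound_uminus:
  assumes "N_function \<phi>" "mgf_bound M \<phi> a \<xi>"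
  shows "mgf_bound M \<phi> a (\<lambda>\<omega>. - \<xi> \<omega>)"
proof -
  have e: "\<phi> (- x) = \<phi> x" for x using assms(1) by (simp add: N_function_def)
  have "integrable M (\<lambda>\<omega>. exp (- l * \<xi> \<omega>)) \<and> (\<integral>\<omega>. exp (- l * \<xi> \<omega>) \<partial>M) \<le> exp (\<phi> (- l * a))" for l
    using assms(2) unfolding mgf_bound_def by blast
  then show ?thesis using assms(2) e unfolding mgf_bound_def by simp
qed

text \<open>The triangle inequality for the norm. Writing \<open>l * (\<xi> + \<eta>)\<close> as the convex combination of
\<open>l / w * \<xi>\<close> and \<open>l / (1 - w) * \<eta>\<close> with \<open>w = a / (a + b)\<close> brings both summands to the same
bound, so convexity of \<open>exp\<close> replaces the inequality of Hoelder.\<close>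

lemma mgf_bound_add:
  assumes "mgf_bound M \<phi> a \<xi>" "mgf_bound M \<phi> b \<eta>" "0 < a" "0 < b"
  shows "mgf_bound M \<phi> (a + b) (\<lambda>\<omega>. \<xi> \<omega> + \<eta> \<omega>)"
proof -
  define w where "w = a / (a + b)"
  have w: "0 < w" "w < 1" "a / w = a + b" "b / (1 - w) = a + b"
    using assms(3,4) by (auto simp: w_def field_simps)
  have [measurable]: "\<xi> \<in> borel_measurable M" "\<eta> \<in> borel_measurable M"
    using assms by (auto simp: mgf_bound_def)
  have *: "integrable M (\<lambda>\<omega>. exp (l * (\<xi> \<omega> + \<eta> \<omega>))) \<and>
      (\<integral>\<omega>. exp (l * (\<xi> \<omega> + \<eta> \<omega>)) \<partial>M) \<le> exp (\<phi> (l * (a + b)))" for l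
  proof -
    let ?U = "\<lambda>\<omega>. exp (l / w * \<xi> \<omega>)" and ?V = "\<lambda>\<omega>. exp (l / (1 - w) * \<eta> \<omega>)"
    have U: "integrable M ?U" "(\<integral>\<omega>. ?U \<omega> \<partial>M) \<le> exp (\<phi> (l * (a + b)))"
      using assms(1) w(3) unfolding mgf_bound_def by (metis times_divide_eq_left times_divide_eq_right)+
    have V: "integrable M ?V" "(\<integral>\<omega>. ?V \<omega> \<partial>M) \<le> exp (\<phi> (l * (a + b)))"
      using assms(2) w(4) unfolding mgf_bound_def by (metis times_divide_eq_left times_divide_eq_right)+
    have le: "exp (l * (\<xi> \<omega> + \<eta> \<omega>)) \<le> w * ?U \<omega> + (1 - w) * ?V \<omega>" for \<omega>
    proof -
      have "w * (l / w * \<xi> \<omega>) + (1 - w) * (l / (1 - w) * \<eta> \<omega>) = l * (\<xi> \<omega> + \<eta> \<omega>)"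
        using w(1,2) by (simp add: distrib_left)
      then show ?thesis
        using convex_onD[OF exp_convex, of "1 - w" "l / w * \<xi> \<omega>" "l / (1 - w) * \<eta> \<omega>"] w by simp
    qed
    have iR: "integrable M (\<lambda>\<omega>. w * ?U \<omega> + (1 - w) * ?V \<omega>)"
      using U V by auto
    have i: "integrable M (\<lambda>\<omega>. exp (l * (\<xi> \<omega> + \<eta> \<omega>)))"
      by (rule Bochner_Integration.integrable_bound[OF iR]) (use le in \<open>auto intro!: AE_I2 order_trans[OF le]\<close>)
    have "(\<integral>\<omega>. exp (l * (\<xi> \<omega> + \<eta> \<omega>)) \<partial>M) \<le> (\<integral>\<omega>. w * ?U \<omega> + (1 - w) * ?V \<omega> \<partial>M)"
      by (rule integral_mono[OF i iR le])
    also have "\<dots> = w * (\<integral>\<omega>. ?U \<omega> \<partial>M) + (1 - w) * (\<integral>\<omega>. ?V \<omega> \<partial>M)"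
      using U V by simp
    also have "\<dots> \<le> w * exp (\<phi> (l * (a + b))) + (1 - w) * exp (\<phi> (l * (a + b)))"
      using U V w by (intro add_mono mult_left_mono) auto
    finally show ?thesis using i by (simp add: algebra_simps)
  qed
  then show ?thesis by (auto simp: mgf_bound_def)
qed

text \<open>The admissible numbers form a closed set because \<open>\<phi>\<close> is continuous, so the norm itself is admissible.\<close>

lemma tau_phi_attained:
  assumes N: "N_function \<phi>" and b: "mgf_bound M \<phi> a \<xi>" "0 \<le> a"
  shows "0 \<le> tau_phi M \<phi> \<xi>" "mgf_bound M \<phi> (tau_phi M \<phi> \<xi>) \<xi>" "tau_phi M \<phi> \<xi> \<le> a"
proof -
  let ?A = "{a. 0 \<le> a \<and> (\<forall>l. (\<integral>\<omega>. exp (l * \<xi> \<omega>) \<partial>M) \<le> exp (\<phi> (l * a)))}"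
  have c: "continuous_on UNIV \<phi>" using N by (simp add: N_function_def)
  have "closed ?A"
    by (intro closed_Collect_conj closed_Collect_le closed_Collect_all continuous_intros
        continuous_on_compose2[OF c]) auto
  moreover have a: "a \<in> ?A" using b by (auto simp: mgf_bound_def)
  moreover have bd: "bdd_below ?A" by (auto intro: bdd_belowI)
  ultimately have "Inf ?A \<in> ?A" by (intro closed_contains_Inf) auto
  then show "0 \<le> tau_phi M \<phi> \<xi>" "mgf_bound M \<phi> (tau_phi M \<phi> \<xi>) \<xi>"
    using b unfolding tau_phi_def[symmetric] by (auto simp: mgf_bound_def)
  show "tau_phi M \<phi> \<xi> \<le> a" unfolding tau_phi_def using a bd by (rule cInf_lower)
qed

lemma Sub_phi_imp_mgf_bound:
  assumes "\<xi> \<in> Sub_phi M \<phi>" shows "\<exists>a>0. mgf_bound M \<phi> a \<xi>"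
  using assms by (auto simp: Sub_phi_def mgf_bound_def)

text \<open>Markov's inequality with exponent \<open>l \<rightarrow> \<infinity>\<close>. This settles \<open>\<gamma> = 0\<close>, where the threshold
on \<open>x\<close> is a division by zero and reads \<open>x > 0\<close>.\<close>

lemma mgf_bound_zero_imp_AE_le:
  assumes "prob_space M" "mgf_bound M \<phi> 0 \<xi>" "\<phi> 0 = 0"
  shows "AE \<omega> in M. \<xi> \<omega> \<le> 0"
proof -
  interpret prob_space M by fact
  have [measurable]: "\<xi> \<in> borel_measurable M" using assms by (simp add: mgf_bound_def)
  have "AE \<omega> in M. \<xi> \<omega> < x" if "x > 0" for x
  proof -
    have "measure M {\<omega> \<in> space M. \<xi> \<omega> \<ge> x} \<le> exp (- l * x)" if "l > 0" for l
    proof -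
      have i: "integrable M (\<lambda>\<omega>. exp (l * \<xi> \<omega>))" "(\<integral>\<omega>. exp (l * \<xi> \<omega>) \<partial>M) \<le> 1"
        using assms unfolding mgf_bound_def by (auto dest: spec[of _ l])
      have "measure M {\<omega> \<in> space M. exp (l * \<xi> \<omega>) \<ge> exp (l * x)} \<le>
          (\<integral>\<omega>. exp (l * \<xi> \<omega>) \<partial>M) / exp (l * x)"
        by (rule integral_Markov_inequality_measure[OF i(1)]) (auto)
      also have "\<dots> \<le> 1 / exp (l * x)" using i by (simp add: divide_right_mono)
      finally show ?thesis using that by (simp add: exp_minus field_simps)
    qed
    then have "\<forall>\<^sub>F l in at_top. measure M {\<omega> \<in> space M. \<xi> \<omega> \<ge> x} \<le> exp (- l * x)"
      by (auto intro: eventually_mono[OF eventually_gt_at_top[of 0]])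
    moreover have "((\<lambda>l. exp (- l * x)) \<longlongrightarrow> 0) at_top"
      using filterlim_tendsto_pos_mult_at_top[OF tendsto_const that filterlim_ident]
      by (intro filterlim_compose[OF exp_at_bot]) (simp add: filterlim_uminus_at_bot mult.commute)
    ultimately have "measure M {\<omega> \<in> space M. \<xi> \<omega> \<ge> x} \<le> 0"
      by (intro tendsto_le[OF _ _ tendsto_const]) auto
    then have "{\<omega> \<in> space M. \<xi> \<omega> \<ge> x} \<in> null_sets M"
      by (auto simp: null_sets_def emeasure_eq_measure intro: antisym)
    then show ?thesis by (auto dest!: AE_not_in elim!: AE_mp simp: not_le)
  qed
  then have "AE \<omega> in M. \<forall>n::nat. \<xi> \<omega> < 1 / real (Suc n)"
    by (simp add: AE_all_countable)
  then show ?thesis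
  proof eventually_elim
    case (elim \<omega>)
    show ?case
    proof (rule ccontr)
      assume "\<not> \<xi> \<omega> \<le> 0"
      then obtain n where "1 / real (Suc n) < \<xi> \<omega>" using nat_approx_posE[of "\<xi> \<omega>"] by (auto simp del: of_nat_Suc)
      then show False using elim by (meson less_asym)
    qed
  qed
qed

section \<open>Chaining\<close>

text \<open>The core estimate, for a chain of finite sets \<open>D 0, ..., D K\<close> with projections \<open>\<alpha> j\<close> of
\<open>D (Suc j)\<close> to \<open>D j\<close>. On the event in question one term of each level sum \<open>Q j\<close> below is large
enough that the product of the powers \<open>Q j powr w j\<close> is at least \<open>exp (l * x)\<close>. The level sums
have arbitrary joint distribution; the weighted inequality of arithmetic and geometric means,
applied to \<open>Q j\<close> divided by the bound of its expectation, is what allows taking expectations.\<close>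

lemma chaining_tail:
  fixes D :: "nat \<Rightarrow> 'b set" and X :: "'b \<Rightarrow> 'w \<Rightarrow> real"
  assumes "prob_space M" and l: "l > 0"
    and D: "\<And>j. j \<le> K \<Longrightarrow> finite (D j) \<and> D j \<noteq> {}"
    and \<alpha>: "\<And>j t. j < K \<Longrightarrow> t \<in> D (Suc j) \<Longrightarrow> \<alpha> j t \<in> D j"
    and w: "\<And>j. j \<le> K \<Longrightarrow> w j > 0" "(\<Sum>j\<le>K. w j) \<le> 1"
    and b0: "\<And>t. t \<in> D 0 \<Longrightarrow> mgf_bound M \<phi> (b 0) (X t)"
    and bS: "\<And>j t. j < K \<Longrightarrow> t \<in> D (Suc j) \<Longrightarrow>
               mgf_bound M \<phi> (b (Suc j)) (\<lambda>\<omega>. X t \<omega> - X (\<alpha> j t) \<omega>)"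
  shows "measure M {\<omega> \<in> space M. \<exists>t\<in>D K. X t \<omega> > x} \<le>
    exp (- (l * x) + (\<Sum>j\<le>K. w j * (ln (real (card (D j))) + \<phi> (l / w j * b j))))"
proof -
  interpret prob_space M by fact
  define Y where "Y j t = (case j of 0 \<Rightarrow> X t | Suc i \<Rightarrow> (\<lambda>\<omega>. X t \<omega> - X (\<alpha> i t) \<omega>))" for j t
  define Q where "Q j \<omega> = (\<Sum>t\<in>D j. exp (l / w j * Y j t \<omega>))" for j \<omega>
  define c where "c j = ln (real (card (D j))) + \<phi> (l / w j * b j)" for j
  have Y: "mgf_bound M \<phi> (b j) (Y j t)" if "j \<le> K" "t \<in> D j" for j t
    using b0 bS that by (cases j) (auto simp: Y_def)
  have Qi: "integrable M (Q j)" if "j \<le> K" for j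
    unfolding Q_def using Y[OF that] unfolding mgf_bound_def
    by (intro Bochner_Integration.integrable_sum) blast
  have EQ: "(\<integral>\<omega>. Q j \<omega> \<partial>M) \<le> exp (c j)" if "j \<le> K" for j
  proof -
    have "(\<integral>\<omega>. Q j \<omega> \<partial>M) = (\<Sum>t\<in>D j. \<integral>\<omega>. exp (l / w j * Y j t \<omega>) \<partial>M)"
      unfolding Q_def using Y[OF that] unfolding mgf_bound_def
      by (intro Bochner_Integration.integral_sum) blast
    also have "\<dots> \<le> (\<Sum>t\<in>D j. exp (\<phi> (l / w j * b j)))"
      using Y[OF that] unfolding mgf_bound_def by (intro sum_mono) blast
    also have "\<dots> = exp (c j)" using D[OF that] by (simp add: c_def exp_add card_gt_0_iff)
    finally show ?thesis .
  qed
  have Qpos: "Q j \<omega> > 0" if "j \<le> K" for j \<omega>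
    unfolding Q_def using D[OF that] by (intro sum_pos) auto
  have YQ: "l * Y j t \<omega> \<le> w j * ln (Q j \<omega>)" if "j \<le> K" "t \<in> D j" for j t \<omega>
  proof -
    have "exp (l / w j * Y j t \<omega>) \<le> Q j \<omega>"
      unfolding Q_def using that D by (intro member_le_sum) auto
    then have "l / w j * Y j t \<omega> \<le> ln (Q j \<omega>)" using Qpos[OF that(1)] by (simp add: ln_ge_iff)
    then show ?thesis using w(1)[OF that(1)] by (simp add: field_simps)
  qed
  \<comment> \<open>Telescoping along the chain that ends in \<open>t\<close>.\<close>
  have XQ: "l * X t \<omega> \<le> (\<Sum>j\<le>k. w j * ln (Q j \<omega>))" if "k \<le> K" "t \<in> D k" for k t \<omega>
    using that
  proof (induction k arbitrary: t)
    case 0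
    then show ?case using YQ[of 0 t \<omega>] by (simp add: Y_def)
  next
    case (Suc k)
    have "l * X t \<omega> = l * Y (Suc k) t \<omega> + l * X (\<alpha> k t) \<omega>" by (simp add: Y_def algebra_simps)
    also have "\<dots> \<le> w (Suc k) * ln (Q (Suc k) \<omega>) + (\<Sum>j\<le>k. w j * ln (Q j \<omega>))"
      using Suc \<alpha> by (intro add_mono YQ Suc.IH) auto
    finally show ?case by simp
  qed
  \<comment> \<open>The weighted arithmetic mean of the normalised level sums; the missing weight sits at the constant 1.\<close>
  define H where "H \<omega> = (1 - (\<Sum>j\<le>K. w j)) + (\<Sum>j\<le>K. w j * (Q j \<omega> / exp (c j)))" for \<omega>
  have Hi: "integrable M H" unfolding H_def using Qi by (intro Bochner_Integration.integrable_add
      Bochner_Integration.integrable_sum integrable_mult_right integrable_divide) auto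
  have EH: "(\<integral>\<omega>. H \<omega> \<partial>M) \<le> 1"
  proof -
    have "(\<integral>\<omega>. H \<omega> \<partial>M) = (1 - (\<Sum>j\<le>K. w j)) + (\<Sum>j\<le>K. w j * ((\<integral>\<omega>. Q j \<omega> \<partial>M) / exp (c j)))"
      unfolding H_def using Qi by (subst Bochner_Integration.integral_add)
        (auto simp: prob_space intro!: Bochner_Integration.integral_sum[THEN trans])
    also have "\<dots> \<le> (1 - (\<Sum>j\<le>K. w j)) + (\<Sum>j\<le>K. w j * 1)"
      using EQ w by (intro add_mono sum_mono mult_left_mono) (auto simp: less_imp_le)
    finally show ?thesis by simp
  qed
  have amgm: "exp (\<Sum>j\<le>K. w j * (ln (Q j \<omega>) - c j)) \<le> H \<omega>" for \<omega>
    using convex_on_subprob_sum[OF exp_convex, of "Suc K" w "\<lambda>j. ln (Q j \<omega>) - c j"] w Qpos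
    by (simp add: H_def exp_diff lessThan_Suc_atMost less_Suc_eq_le less_imp_le cong: sum.cong_simp)
  let ?C = "(\<Sum>j\<le>K. w j * c j)"
  have sub: "{\<omega> \<in> space M. \<exists>t\<in>D K. X t \<omega> > x} \<subseteq> {\<omega> \<in> space M. H \<omega> \<ge> exp (l * x - ?C)}"
  proof safe
    fix \<omega> t assume t: "t \<in> D K" "x < X t \<omega>"
    have "l * x \<le> l * X t \<omega>" using t l by simp
    also have "\<dots> \<le> (\<Sum>j\<le>K. w j * ln (Q j \<omega>))" using XQ t by simp
    finally have "exp (l * x - ?C) \<le> exp (\<Sum>j\<le>K. w j * (ln (Q j \<omega>) - c j))"
      by (simp add: right_diff_distrib sum_subtractf)
    then show "H \<omega> \<ge> exp (l * x - ?C)" using amgm[of \<omega>] by linarith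
  qed
  have Hm[measurable]: "H \<in> borel_measurable M" using Hi by simp
  have "measure M {\<omega> \<in> space M. \<exists>t\<in>D K. X t \<omega> > x} \<le> measure M {\<omega> \<in> space M. H \<omega> \<ge> exp (l * x - ?C)}"
    by (rule finite_measure_mono[OF sub]) measurable
  also have "\<dots> \<le> (\<integral>\<omega>. H \<omega> \<partial>M) / exp (l * x - ?C)"
    by (rule integral_Markov_inequality_measure[OF Hi])
      (auto intro!: AE_I2 order_trans[OF _ amgm])
  also have "\<dots> \<le> 1 / exp (l * x - ?C)" using EH by (intro divide_right_mono) auto
  also have "\<dots> = exp (- (l * x) + ?C)" by (simp add: exp_diff exp_minus exp_add field_simps)
  finally show ?thesis unfolding c_def .
qed

text \<open>With the weights \<open>(1 - p) * p ^ j\<close> and increments of size \<open>\<beta> * p ^ j\<close> all levels but the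
coarsest carry the same bound. The nets occupy the levels below \<open>K\<close> and the target set \<open>T\<close> the
level \<open>K\<close>; since \<open>L\<close> bounds the entropy cost for every depth, letting \<open>K \<rightarrow> \<infinity>\<close> makes the
cost of \<open>T\<close> disappear.\<close>

lemma geometric_chaining_tail:
  fixes X :: "'b \<Rightarrow> 'w \<Rightarrow> real" and V :: "nat \<Rightarrow> 'b set"
  assumes "prob_space M" and N: "N_function \<phi>" and p: "0 < p" "p < 1" and l: "l > 0"
    and V: "\<And>j. finite (V j) \<and> V j \<noteq> {} \<and> V j \<subseteq> B"
    and net: "\<And>j t. t \<in> B \<Longrightarrow> \<exists>v\<in>V j. mgf_bound M \<phi> (\<beta> * p ^ Suc j) (\<lambda>\<omega>. X t \<omega> - X v \<omega>)"
    and \<gamma>: "\<And>t. t \<in> B \<Longrightarrow> mgf_bound M \<phi> \<gamma> (X t)"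
    and L: "\<And>K. (\<Sum>j<K. (1 - p) * p ^ j * ln (real (card (V j)))) \<le> L"
    and T: "finite T" "T \<subseteq> B"
  shows "measure M {\<omega> \<in> space M. \<exists>t\<in>T. X t \<omega> > x} \<le>
    exp (- (l * x) + ((1 - p) * \<phi> (l * \<gamma> / (1 - p)) + p * \<phi> (l * \<beta> / (1 - p)) + L))"
proof (cases "T = {}")
  case True
  then show ?thesis by simp
next
  case False
  let ?f\<gamma> = "\<phi> (l * \<gamma> / (1 - p))" and ?f\<beta> = "\<phi> (l * \<beta> / (1 - p))"
  define w where "w j = (1 - p) * p ^ j" for j
  have w0: "w j > 0" for j using p by (simp add: w_def)
  have ws: "(\<Sum>j<n. w j) = 1 - p ^ n" for n
    using p by (simp add: w_def sum_distrib_left[symmetric] sum_gp_strict)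
  define \<alpha> where "\<alpha> j t = (SOME v. v \<in> V j \<and>
      mgf_bound M \<phi> (\<beta> * p ^ Suc j) (\<lambda>\<omega>. X t \<omega> - X v \<omega>))" for j t
  have \<alpha>: "\<alpha> j t \<in> V j" "mgf_bound M \<phi> (\<beta> * p ^ Suc j) (\<lambda>\<omega>. X t \<omega> - X (\<alpha> j t) \<omega>)"
    if "t \<in> B" for j t
    using someI_ex[OF net[OF that, of j, unfolded Bex_def]] by (auto simp: \<alpha>_def)
  have bnd: "measure M {\<omega> \<in> space M. \<exists>t\<in>T. X t \<omega> > x} \<le>
      exp (- (l * x) + ((1 - p) * ?f\<gamma> + p * ?f\<beta> + L + w K * ln (card T)))" for K
  proof -
    define D where "D j = (if j < K then V j else T)" for j
    define b where "b j = (case j of 0 \<Rightarrow> \<gamma> | Suc i \<Rightarrow> \<beta> * p ^ Suc i)" for j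
    have DB: "D j \<subseteq> B" for j using V T by (auto simp: D_def)
    have "measure M {\<omega> \<in> space M. \<exists>t\<in>D K. X t \<omega> > x} \<le>
        exp (- (l * x) + (\<Sum>j\<le>K. w j * (ln (real (card (D j))) + \<phi> (l / w j * b j))))"
    proof (rule chaining_tail[where \<alpha> = \<alpha>])
      show "finite (D j) \<and> D j \<noteq> {}" for j using V T False by (auto simp: D_def)
      show "\<alpha> j t \<in> D j" if "j < K" "t \<in> D (Suc j)" for j t
        using that \<alpha>(1)[of t j] DB by (auto simp: D_def)
      show "(\<Sum>j\<le>K. w j) \<le> 1"
        using ws[of "Suc K"] p by (simp add: lessThan_Suc_atMost)
      show "mgf_bound M \<phi> (b 0) (X t)" if "t \<in> D 0" for t using that DB \<gamma> by (auto simp: b_def)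
      show "mgf_bound M \<phi> (b (Suc j)) (\<lambda>\<omega>. X t \<omega> - X (\<alpha> j t) \<omega>)" if "t \<in> D (Suc j)" for j t
        using that DB[of "Suc j"] \<alpha>(2)[of t j] by (auto simp: b_def)
    qed (use assms(1) l w0 in \<open>auto simp del: power_Suc\<close>)
    also have "\<dots> \<le> exp (- (l * x) + ((1 - p) * ?f\<gamma> + p * ?f\<beta> + L + w K * ln (card T)))"
    proof -
      have "(\<Sum>j\<le>K. w j * ln (real (card (D j)))) = (\<Sum>j<K. w j * ln (real (card (V j)))) + w K * ln (card T)"
        by (simp add: D_def flip: lessThan_Suc_atMost)
      also have "\<dots> \<le> L + w K * ln (card T)" using L[of K] by (simp add: w_def)
      finally have 1: "(\<Sum>j\<le>K. w j * ln (real (card (D j)))) \<le> L + w K * ln (card T)" .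
      have "(\<Sum>j\<le>K. w j * \<phi> (l / w j * b j)) = w 0 * ?f\<gamma> + (\<Sum>j<K. w (Suc j) * ?f\<beta>)"
        using p by (subst sum.atMost_shift) (simp add: w_def b_def)
      also have "\<dots> = (1 - p) * ?f\<gamma> + p * (1 - p ^ K) * ?f\<beta>"
        using ws[of K] by (simp add: w_def sum_distrib_left[symmetric] sum_distrib_right[symmetric] mult.assoc mult.left_commute)
      also have "\<dots> \<le> (1 - p) * ?f\<gamma> + p * ?f\<beta>"
        using N_function_nonneg[OF N, of "l * \<beta> / (1 - p)"] p
        by (intro add_mono order_refl mult_right_mono) (auto simp: mult_left_le)
      finally show ?thesis using 1 by (simp add: distrib_left sum.distrib)
    qed
    finally show ?thesis by (simp add: D_def)
  qed
  have "(\<lambda>K. exp (- (l * x) + ((1 - p) * ?f\<gamma> + p * ?f\<beta> + L + (1 - p) * p ^ K * ln (card T)))) \<longlonglongrightarrow>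
      exp (- (l * x) + ((1 - p) * ?f\<gamma> + p * ?f\<beta> + L + (1 - p) * 0 * ln (card T)))"
    using p by (intro tendsto_intros LIMSEQ_power_zero) auto
  then show ?thesis
    using bnd by (intro LIMSEQ_le_const[where x = "exp _"]) (auto simp: w_def)
qed

section \<open>From finite sets to the whole index set\<close>

lemma measure_countable_ex_le:
  assumes "finite_measure M" "countable S" and m: "\<And>t. t \<in> S \<Longrightarrow> X t \<in> borel_measurable M"
    and bd: "\<And>T. finite T \<Longrightarrow> T \<subseteq> S \<Longrightarrow> measure M {\<omega> \<in> space M. \<exists>t\<in>T. X t \<omega> > (x::real)} \<le> c"
  shows "measure M {\<omega> \<in> space M. \<exists>t\<in>S. X t \<omega> > x} \<le> c"
proof (cases "S = {}")
  case True then show ?thesis using bd[of "{}"] by simp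
next
  case False
  interpret finite_measure M by fact
  let ?A = "\<lambda>n. {\<omega> \<in> space M. \<exists>t \<in> from_nat_into S ` {..n}. X t \<omega> > x}"
  have sub: "from_nat_into S ` {..n} \<subseteq> S" for n using False by (auto intro: from_nat_into)
  have "(\<lambda>n. measure M (?A n)) \<longlonglongrightarrow> measure M (\<Union>n. ?A n)"
  proof (rule finite_Lim_measure_incseq)
    show "range ?A \<subseteq> sets M"
    proof safe
      fix n
      have "Measurable.pred M (\<lambda>\<omega>. X t \<omega> > x)" if "t \<in> from_nat_into S ` {..n}" for t
      proof -
        have [measurable]: "X t \<in> borel_measurable M" using m that sub by blast
        show ?thesis by measurable
      qed
      then show "?A n \<in> sets M" by (intro sets.sets_Collect_finite_Ex) (auto simp: pred_def)
    qed
    show "incseq ?A" by (rule incseq_SucI) (auto intro: le_SucI)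
  qed
  moreover have "(\<Union>n. ?A n) = {\<omega> \<in> space M. \<exists>t\<in>S. X t \<omega> > x}"
    using False sub from_nat_into_surj[OF assms(2)] by (auto simp: image_iff) blast+
  moreover have "measure M (?A n) \<le> c" for n by (rule bd) (use sub in auto)
  ultimately show ?thesis by (intro LIMSEQ_le_const2[where X = "\<lambda>n. measure M (?A n)"]) auto
qed

text \<open>A set that exceeds an event by part of a null set; separability puts the exceedance events of the
uncountable family in this position.\<close>

lemma completion_measure_eqI:
  assumes "N \<in> null_sets M" "A \<in> sets M" "A \<subseteq> C" "C - A \<subseteq> N"
  shows "C \<in> sets (completion M) \<and> measure (completion M) C = measure M A"
proof -
  have n: "C - A \<in> null_sets (completion M)" using assms null_sets_completion_subset
    by (meson null_sets_completionI)
  have "C = A \<union> (C - A)" using assms by auto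
  then show ?thesis using n assms
    by (metis measure_Un_null_set measure_completion null_setsD2 sets.Un sets_completionI_sets)
qed

section \<open>Covering numbers and inverse functions\<close>

lemma covering_number_net:
  assumes "Metric_space B \<rho>" "compact_space (Metric_space.mtopology B \<rho>)" "u > 0"
  obtains V where "finite V" "V \<subseteq> B" "card V = covering_number B \<rho> u"
    "\<And>t. t \<in> B \<Longrightarrow> \<exists>v\<in>V. \<rho> v t \<le> u"
proof -
  interpret Metric_space B \<rho> by fact
  have tb: "mtotally_bounded B"
    using assms(2) by (simp add: compact_space_def compactin_imp_mtotally_bounded)
  obtain K where "finite K" "K \<subseteq> B" "B \<subseteq> (\<Union>x\<in>K. mball x u)"
    using tb[unfolded mtotally_bounded_def, rule_format, OF assms(3)] by (elim exE conjE)
  moreover have "(\<Union>x\<in>K. mball x u) \<subseteq> (\<Union>x\<in>K. mcball x u)"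
    using mball_subset_mcball by (rule UN_mono[OF order_refl])
  ultimately have "\<exists>n C. C \<subseteq> B \<and> finite C \<and> card C = n \<and> B \<subseteq> (\<Union>c\<in>C. mcball c u)"
    by (intro exI[of _ "card K"] exI[of _ K]) auto
  from LeastI_ex[OF this]
  obtain V where V: "V \<subseteq> B" "finite V" "card V = covering_number B \<rho> u" "B \<subseteq> (\<Union>c\<in>V. mcball c u)"
    unfolding covering_number_def[symmetric] by (elim exE conjE)
  then have "\<exists>v\<in>V. \<rho> v t \<le> u" if "t \<in> B" for t using that by (auto dest!: subsetD)
  then show thesis using V that by blast
qed

lemma covering_number_antimono:
  assumes "Metric_space B \<rho>" "compact_space (Metric_space.mtopology B \<rho>)" "0 < u" "u \<le> u'"
  shows "covering_number B \<rho> u' \<le> covering_number B \<rho> u"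
proof -
  interpret Metric_space B \<rho> by fact
  obtain V where "finite V" "V \<subseteq> B" "card V = covering_number B \<rho> u"
    "\<And>t. t \<in> B \<Longrightarrow> \<exists>v\<in>V. \<rho> v t \<le> u"
    using covering_number_net[OF assms(1-3)] by metis
  moreover from this have "B \<subseteq> (\<Union>c\<in>V. mcball c u')" using assms(4) by fastforce
  ultimately show ?thesis unfolding covering_number_def[of B \<rho> u'] by (intro Least_le) blast
qed

lemma covering_number_pos:
  assumes "Metric_space B \<rho>" "compact_space (Metric_space.mtopology B \<rho>)" "B \<noteq> {}" "0 < u"
  shows "1 \<le> covering_number B \<rho> u"
proof -
  obtain V where "finite V" "card V = covering_number B \<rho> u" "\<And>t. t \<in> B \<Longrightarrow> \<exists>v\<in>V. \<rho> v t \<le> u"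
    using covering_number_net[OF assms(1,2,4)] by metis
  then show ?thesis using assms(3) by (metis One_nat_def Suc_leI all_not_in_conv card_gt_0_iff)
qed

text \<open>Since \<open>\<sigma>\<close> tends to 0 at 0, the intermediate value theorem puts every \<open>y\<close> with
\<open>0 < y \<le> \<sigma> r\<close> in its range.\<close>

lemma modulus_inverse:
  fixes \<sigma> :: "real \<Rightarrow> real"
  assumes c: "continuous_on {0<..} \<sigma>" and m: "strict_mono_on {0<..} \<sigma>"
    and lim: "(\<sigma> \<longlongrightarrow> 0) (at_right 0)" and "0 < y" "y \<le> \<sigma> r" "0 < r"
  shows "0 < the_inv_into {0<..} \<sigma> y" "\<sigma> (the_inv_into {0<..} \<sigma> y) = y"
proof -
  have "\<forall>\<^sub>F h in at_right 0. \<sigma> h < y \<and> h < r \<and> 0 < h"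
    using order_tendstoD(2)[OF lim assms(4)] assms(6)
    by (intro eventually_conj eventually_at_right_less) (auto intro: eventually_at_right_real[THEN eventually_mono])
  then obtain h where h: "\<sigma> h < y" "h < r" "0 < h"
    using eventually_happens by (metis (no_types, lifting) trivial_limit_at_right_real)
  then obtain z where "h \<le> z" "z \<le> r" "\<sigma> z = y"
    using IVT'[of \<sigma> h y r] assms(5) continuous_on_subset[OF c, of "{h..r}"] by fastforce
  then have "y \<in> \<sigma> ` {0<..}" using h by (auto intro!: image_eqI[of _ _ z])
  moreover have "inj_on \<sigma> {0<..}" using m by (rule strict_mono_on_imp_inj_on)
  ultimately show "0 < the_inv_into {0<..} \<sigma> y" "\<sigma> (the_inv_into {0<..} \<sigma> y) = y"
    using the_inv_into_into[of \<sigma> "{0<..}" y "{0<..}"] f_the_inv_into_f[of \<sigma> "{0<..}" y] by auto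
qed

text \<open>The point 0 occurs as the logarithm of a covering number whenever one ball suffices. The inequality
there is the limit of the inequality for arguments shifted to the right.\<close>

lemma convex_on_atLeast_zero:
  fixes f :: "real \<Rightarrow> real"
  assumes cv: "convex_on {0<..} f" and c: "continuous_on {0..} f"
  shows "convex_on {0..} f"
proof (rule convex_onI)
  fix t x y :: real assume *: "0 < t" "t < 1" "x \<in> {0..}" "y \<in> {0..}"
  have lim: "((\<lambda>d. f (z + d)) \<longlongrightarrow> f z) (at_right 0)" if "z \<ge> 0" for z
  proof (rule continuous_on_tendsto_compose[OF c])
    have "((\<lambda>d. z + d) \<longlongrightarrow> z + 0) (at_right 0)" by (intro tendsto_intros)
    then show "((\<lambda>d. z + d) \<longlongrightarrow> z) (at_right 0)" by simp
    show "\<forall>\<^sub>F d in at_right 0. z + d \<in> {0..}"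
      using eventually_at_right_less[of 0] by eventually_elim (use that in auto)
  qed (use that in auto)
  have "f ((1 - t) * x + t * y) \<le> (1 - t) * f x + t * f y"
  proof (rule tendsto_le[OF trivial_limit_at_right_real])
    show "((\<lambda>d. f ((1 - t) * x + t * y + d)) \<longlongrightarrow> f ((1 - t) * x + t * y)) (at_right 0)"
      using * by (intro lim) auto
    show "((\<lambda>d. (1 - t) * f (x + d) + t * f (y + d)) \<longlongrightarrow> (1 - t) * f x + t * f y) (at_right 0)"
      using * by (intro tendsto_intros lim) auto
    show "\<forall>\<^sub>F d in at_right 0. f ((1 - t) * x + t * y + d) \<le> (1 - t) * f (x + d) + t * f (y + d)"
      using eventually_at_right_less[of 0]
    proof eventually_elim
      case (elim d)
      have "(1 - t) * x + t * y + d = (1 - t) * (x + d) + t * (y + d)" by (simp add: algebra_simps)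
      then show ?case using convex_onD[OF cv, of t "x + d" "y + d"] * elim by simp
    qed
  qed
  then show "f ((1 - t) *\<^sub>R x + t *\<^sub>R y) \<le> (1 - t) * f x + t * f y" by simp
qed simp

text \<open>A convex strictly increasing function is unbounded, since it lies above its chords extended to the
right. So \<open>r1\<close> takes every value above \<open>r1 1\<close>, and the inverse function in the bound is
evaluated inside its domain.\<close>

lemma log_convex_inverse:
  fixes r1 :: "real \<Rightarrow> real"
  assumes c: "continuous_on {1..} r1" and m: "strict_mono_on {1..} r1"
    and cv: "convex_on {0<..} (\<lambda>t. r1 (exp t))" and y: "r1 1 \<le> y"
  shows "1 \<le> the_inv_into {1..} r1 y" "r1 (the_inv_into {1..} r1 y) = y"
proof -
  define d where "d = r1 (exp 2) - r1 (exp 1)"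
  have d: "d > 0" using strict_mono_onD[OF m, of "exp 1" "exp 2"] by (simp add: d_def)
  \<comment> \<open>The chord of \<open>r1 \<circ> exp\<close> over \<open>{1..2}\<close> reaches the height \<open>y\<close> before this point.\<close>
  define n where "n = 2 + \<bar>y - r1 (exp 1)\<bar> / d"
  have "(n - 1) * d = d + \<bar>y - r1 (exp 1)\<bar>" using d by (simp add: n_def field_simps)
  then have n: "n \<ge> 2" "(n - 1) * d \<ge> y - r1 (exp 1)" using d by (auto simp: n_def)
  have "r1 (exp ((1 - 1/(n-1)) * 1 + (1/(n-1)) * n)) \<le> (1 - 1/(n-1)) * r1 (exp 1) + 1/(n-1) * r1 (exp n)"
    using convex_onD[OF cv, of "1/(n-1)" 1 n] n by simp
  moreover have "(1 - 1/(n-1)) * 1 + (1/(n-1)) * n = 2"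
  proof -
    have "1/(n-1) * (n-1) = 1" using n by simp
    then show ?thesis by (simp only: right_diff_distrib left_diff_distrib)
  qed
  ultimately have "d \<le> 1/(n-1) * (r1 (exp n) - r1 (exp 1))" by (simp add: d_def algebra_simps)
  then have "(n - 1) * d \<le> r1 (exp n) - r1 (exp 1)" using n by (simp add: field_simps)
  then have "y \<le> r1 (exp n)" using n by simp
  then obtain z where "1 \<le> z" "r1 z = y"
    using IVT'[of r1 1 y "exp n"] y n continuous_on_subset[OF c, of "{1..exp n}"] by fastforce
  then have "y \<in> r1 ` {1..}" by auto
  moreover have "inj_on r1 {1..}" using m by (rule strict_mono_on_imp_inj_on)
  ultimately show "1 \<le> the_inv_into {1..} r1 y" "r1 (the_inv_into {1..} r1 y) = y"
    using the_inv_into_into[of r1 "{1..}" y "{1..}"] f_the_inv_into_f[of r1 "{1..}" y] by auto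
qed

text \<open>A lower Riemann sum for the geometric partition of \<open>{0<..<\<beta> * p}\<close>: the cell with right end
\<open>\<beta> * p ^ Suc j\<close> is the fraction \<open>(1 - p) * p ^ j\<close> of the interval. On the remaining initial
piece, the fraction \<open>p ^ K\<close>, only the lower bound \<open>m\<close> enters, to match the mass that
\<open>convex_on_subprob_sum\<close> places at the origin.\<close>

lemma antimono_average_ge_geometric_sum:
  fixes g :: "real \<Rightarrow> real"
  assumes p: "0 < p" "p < 1" and "0 < \<beta>"
    and i: "set_integrable lborel {0<..<\<beta>} g"
    and anti: "\<And>u v. 0 < u \<Longrightarrow> u \<le> v \<Longrightarrow> v < \<beta> \<Longrightarrow> g v \<le> g u"
    and m: "\<And>u. 0 < u \<Longrightarrow> u < \<beta> \<Longrightarrow> m \<le> g u"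
  shows "(\<Sum>j<K. (1 - p) * p ^ j * g (\<beta> * p ^ Suc j)) + p ^ K * m
    \<le> 1 / (\<beta> * p) * (LBINT u:{0<..<\<beta> * p}. g u)"
proof -
  have p1: "p ^ Suc j < 1" "0 < p ^ j" for j using p power_Suc_less_one[of p j] by auto
  have "(LBINT u:{0<..<\<beta> * p}. g u) \<ge>
      (LBINT u:{0<..<\<beta> * p ^ Suc K}. g u) + \<beta> * p * (\<Sum>j<K. (1 - p) * p ^ j * g (\<beta> * p ^ Suc j))"
  proof (induction K)
    case 0 then show ?case by simp
  next
    case (Suc K)
    define a where "a = \<beta> * p ^ Suc K"
    have a: "0 < a" "a < \<beta>" "a * p < a" "0 < a * p"
      using p p1[of K] p1(2)[of "Suc K"] \<open>0 < \<beta>\<close> by (auto simp: a_def)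
    have i1: "set_integrable lborel {0<..<a * p} g" and i2: "set_integrable lborel {a * p..<a} g"
      by (rule set_integrable_subset[OF i]; use a in auto)+
    have "{0<..<a} = {0<..<a * p} \<union> {a * p..<a}" using a by auto
    then have "(LBINT u:{0<..<a}. g u) = (LBINT u:{0<..<a * p}. g u) + (LBINT u:{a * p..<a}. g u)"
      using set_integral_Un[OF _ i1 i2] by (simp add: ivl_disj_int)
    moreover have "(LBINT u:{a * p..<a}. g a) \<le> (LBINT u:{a * p..<a}. g u)"
      using a i2 by (intro set_integral_mono) 
        (auto intro!: anti integrable_real_indicator simp: set_integrable_def less_imp_le)
    moreover have "(LBINT u:{a * p..<a}. g a) = (a - a * p) * g a"
      using a by (simp add: set_lebesgue_integral_def less_imp_le)
    ultimately have "(LBINT u:{0<..<a}. g u) \<ge> (LBINT u:{0<..<a * p}. g u) + (a - a * p) * g a"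
      by simp
    then show ?case using Suc by (simp add: a_def algebra_simps)
  qed
  moreover have "\<beta> * p ^ Suc K * m \<le> (LBINT u:{0<..<\<beta> * p ^ Suc K}. g u)"
  proof -
    let ?I = "{0<..<\<beta> * p ^ Suc K}"
    have s: "\<beta> * p ^ Suc K < \<beta>" "0 < \<beta> * p ^ Suc K" using p1[of K] p1(2)[of "Suc K"] \<open>0 < \<beta>\<close> by auto
    have "(LBINT u:?I. m) \<le> (LBINT u:?I. g u)"
      using s by (intro set_integral_mono set_integrable_subset[OF i]) 
        (auto intro!: m integrable_real_indicator simp: set_integrable_def less_imp_le)
    then show ?thesis using s by (simp add: set_lebesgue_integral_def less_imp_le)
  qed
  ultimately have "\<beta> * p * ((\<Sum>j<K. (1 - p) * p ^ j * g (\<beta> * p ^ Suc j)) + p ^ K * m)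
      \<le> (LBINT u:{0<..<\<beta> * p}. g u)"
    by (simp add: algebra_simps)
  then show ?thesis using p \<open>0 < \<beta>\<close> by (simp add: field_simps)
qed

section \<open>The tail of the supremum\<close>

text \<open>The exponent \<open>- (m * q * x) + A * m powr \<zeta> / \<zeta>\<close> is minimal in \<open>m\<close> where
\<open>m powr (\<zeta> - 1) = x * q / A\<close>. In this parameter the threshold on \<open>x\<close> becomes \<open>m * v > 1\<close>.\<close>

lemma power_exponent_optimum:
  fixes \<zeta> x q A :: real
  assumes "\<zeta> > 1" "x > 0" "q > 0" "A > 0"
  defines "m \<equiv> (x * q / A) powr (1 / (\<zeta> - 1))"
  shows "m > 0"
    and "- (m * q * x) + A * m powr \<zeta> / \<zeta> =
      (1 - \<zeta>) * (x * q) powr (\<zeta> / (\<zeta> - 1)) / (\<zeta> * A powr (1 / (\<zeta> - 1)))"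
    and "v > 0 \<Longrightarrow> x > A / (q * v powr (\<zeta> - 1)) \<Longrightarrow> m * v > 1"
proof -
  show m0: "m > 0" using assms by (simp add: m_def)
  have m1: "m powr (\<zeta> - 1) = x * q / A" using assms by (simp add: m_def powr_powr)
  have "m powr \<zeta> = m powr (\<zeta> - 1) * m" using m0 by (simp add: powr_diff)
  then have m2: "A * m powr \<zeta> = m * q * x" using m1 assms by simp
  have "\<zeta> / (\<zeta> - 1) = 1 + 1 / (\<zeta> - 1)" using assms by (simp add: field_simps)
  then have "(x * q) powr (\<zeta> / (\<zeta> - 1)) / A powr (1 / (\<zeta> - 1)) = (x * q) * m"
    using assms by (simp add: m_def powr_add powr_divide)
  then have "(1 - \<zeta>) * (x * q) powr (\<zeta> / (\<zeta> - 1)) / (\<zeta> * A powr (1 / (\<zeta> - 1))) = (1 - \<zeta>) * (x * q * m) / \<zeta>"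
    by (metis (no_types, lifting) divide_divide_eq_left mult.commute times_divide_eq_right)
  also have "\<dots> = - (m * q * x) + A * m powr \<zeta> / \<zeta>"
    unfolding m2 using assms by (simp add: field_simps)
  finally show "- (m * q * x) + A * m powr \<zeta> / \<zeta> =
      (1 - \<zeta>) * (x * q) powr (\<zeta> / (\<zeta> - 1)) / (\<zeta> * A powr (1 / (\<zeta> - 1)))" by simp
  assume v: "v > 0" "x > A / (q * v powr (\<zeta> - 1))"
  have "(m * v) powr (\<zeta> - 1) = x * q / A * v powr (\<zeta> - 1)" using m0 v m1 by (simp add: powr_mult)
  also have "\<dots> > 1" using v assms by (simp add: field_simps)
  finally show "m * v > 1"
    using powr_mono2[of "\<zeta> - 1" "m * v" 1] m0 v(1) assms(1)
    by (cases "m * v \<le> 1") auto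
qed

text \<open>The hypotheses on the process in terms of exponential moment bounds. In this form they are visibly
invariant under \<open>X \<mapsto> - X\<close>, which yields the lower tail.\<close>

locale phi_chaining = prob_space M + Metric_space B \<rho>
  for M :: "'w measure" and B :: "'b set" and \<rho> +
  fixes X :: "'b \<Rightarrow> 'w \<Rightarrow> real" and \<phi> \<sigma> r1 :: "real \<Rightarrow> real" and r \<beta> \<gamma> :: real
  assumes N_fun: "N_function \<phi>"
    and B_ne: "B \<noteq> {}" and B_compact: "compact_space mtopology"
    and \<sigma>_cont: "continuous_on {0<..} \<sigma>" and \<sigma>_mono: "strict_mono_on {0<..} \<sigma>"
    and \<sigma>_lim: "(\<sigma> \<longlongrightarrow> 0) (at_right 0)"
    and r_pos: "r > 0" and \<beta>_eq: "\<beta> = \<sigma> r" and \<beta>_pos: "\<beta> > 0"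
    and r1_cont: "continuous_on {1..} r1" and r1_mono: "strict_mono_on {1..} r1"
    and r1_convex: "convex_on {0<..} (\<lambda>t. r1 (exp t))"
    and entropy_int: "set_integrable lborel {0<..<\<beta>} (entropy_integrand B \<rho> \<sigma> r1)"
    and increments: "\<And>t s h. t \<in> B \<Longrightarrow> s \<in> B \<Longrightarrow> h > 0 \<Longrightarrow> \<rho> t s \<le> h \<Longrightarrow>
           mgf_bound M \<phi> (\<sigma> h) (\<lambda>\<omega>. X t \<omega> - X s \<omega>)"
    and marginals: "\<And>t. t \<in> B \<Longrightarrow> mgf_bound M \<phi> \<gamma> (X t)"
begin

lemma phi_chaining_uminus: "phi_chaining M B \<rho> (\<lambda>t \<omega>. - X t \<omega>) \<phi> \<sigma> r1 r \<beta> \<gamma>"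
proof unfold_locales
  fix t s h assume "t \<in> B" "s \<in> B" "h > 0" "\<rho> t s \<le> h"
  then show "mgf_bound M \<phi> (\<sigma> h) (\<lambda>\<omega>. - X t \<omega> - - X s \<omega>)"
    using mgf_bound_uminus[OF N_fun increments[of t s h]] by simp
qed (use N_fun B_ne B_compact \<sigma>_cont \<sigma>_mono \<sigma>_lim r_pos \<beta>_eq \<beta>_pos r1_cont r1_mono r1_convex
     entropy_int in \<open>auto intro!: mgf_bound_uminus[OF N_fun] marginals\<close>)

abbreviation \<sigma>_inv :: "real \<Rightarrow> real" where "\<sigma>_inv \<equiv> the_inv_into {0<..} \<sigma>"

lemma \<sigma>_inv: "0 < u \<Longrightarrow> u \<le> \<beta> \<Longrightarrow> 0 < \<sigma>_inv u" "0 < u \<Longrightarrow> u \<le> \<beta> \<Longrightarrow> \<sigma> (\<sigma>_inv u) = u"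
  using modulus_inverse[OF \<sigma>_cont \<sigma>_mono \<sigma>_lim, of u r] r_pos \<beta>_eq by auto

lemma \<sigma>_inv_mono:
  assumes "0 < u" "u \<le> v" "v \<le> \<beta>" shows "\<sigma>_inv u \<le> \<sigma>_inv v"
  using \<sigma>_inv[of u] \<sigma>_inv[of v] strict_mono_onD[OF \<sigma>_mono, of "\<sigma>_inv v" "\<sigma>_inv u"] assms
  by (force simp: not_less[symmetric])

definition entropy_factor :: "real \<Rightarrow> real" where
  "entropy_factor p = the_inv_into {1..} r1
     (1 / (\<beta> * p) * (LBINT u:{0<..<\<beta> * p}. entropy_integrand B \<rho> \<sigma> r1 u))"

text \<open>The mean of \<open>ln N\<close> under the chaining weights is at most the logarithm of the generalised mean
defined by \<open>r1\<close>. This is Jensen's inequality for \<open>r1 \<circ> exp\<close> in the form with missing mass, where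
the value \<open>r1 (exp 0) = r1 1\<close> at the origin is a lower bound of the entropy integrand.\<close>

lemma entropy_factor:
  assumes p: "0 < p" "p < 1"
  shows "1 \<le> entropy_factor p"
    and "(\<Sum>j<K. (1 - p) * p ^ j * ln (real (covering_number B \<rho> (\<sigma>_inv (\<beta> * p ^ Suc j)))))
      \<le> ln (entropy_factor p)"
proof -
  let ?g = "entropy_integrand B \<rho> \<sigma> r1" and ?N = "\<lambda>u. real (covering_number B \<rho> (\<sigma>_inv u))"
  let ?I = "1 / (\<beta> * p) * (LBINT u:{0<..<\<beta> * p}. ?g u)"
  have N1: "1 \<le> ?N u" if "0 < u" "u < \<beta>" for u
    using covering_number_pos[OF Metric_space_axioms B_compact B_ne \<sigma>_inv(1)[of u]] that by simp
  have r1_le: "r1 a \<le> r1 b" if "1 \<le> a" "a \<le> b" for a b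
    using strict_mono_onD[OF r1_mono, of a b] that by (cases "a = b") auto
  have anti: "?g v \<le> ?g u" if "0 < u" "u \<le> v" "v < \<beta>" for u v
    unfolding entropy_integrand_def
    using covering_number_antimono[OF Metric_space_axioms B_compact \<sigma>_inv(1)[of u] \<sigma>_inv_mono[of u v]]
      N1[of v] that by (intro r1_le) auto
  have low: "r1 1 \<le> ?g u" if "0 < u" "u < \<beta>" for u
    unfolding entropy_integrand_def using N1[OF that] by (intro r1_le) auto
  have sum_le: "(\<Sum>j<K. (1 - p) * p ^ j * ?g (\<beta> * p ^ Suc j)) + p ^ K * r1 1 \<le> ?I" for K
    by (rule antimono_average_ge_geometric_sum[OF p \<beta>_pos entropy_int anti low])
  have I1: "r1 1 \<le> ?I" using sum_le[of 0] by simp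
  note R = log_convex_inverse[OF r1_cont r1_mono r1_convex I1, folded entropy_factor_def]
  show R1: "1 \<le> entropy_factor p" by (rule R)
  let ?w = "\<lambda>j. (1 - p) * p ^ j"
  let ?L = "\<Sum>j<K. ?w j * ln (?N (\<beta> * p ^ Suc j))"
  have ws: "(\<Sum>j<K. ?w j) = 1 - p ^ K"
    using p by (simp add: sum_distrib_left[symmetric] sum_gp_strict)
  have bp: "0 < \<beta> * p ^ Suc j" "\<beta> * p ^ Suc j < \<beta>" for j
    using p \<beta>_pos power_Suc_less_one[of p j] by auto
  have ln0: "0 \<le> ln (?N (\<beta> * p ^ Suc j))" for j using N1[OF bp] by (intro ln_ge_zero)
  have "continuous_on {0..} (\<lambda>t. r1 (exp t))"
    by (rule continuous_on_compose2[OF r1_cont]) (auto intro!: continuous_intros)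
  from convex_on_atLeast_zero[OF r1_convex this]
  have "r1 (exp ?L) \<le> (1 - (\<Sum>j<K. ?w j)) * r1 (exp 0) + (\<Sum>j<K. ?w j * r1 (exp (ln (?N (\<beta> * p ^ Suc j)))))"
    by (rule convex_on_subprob_sum) (use p ln0 ws in auto)
  also have "\<dots> = (\<Sum>j<K. ?w j * ?g (\<beta> * p ^ Suc j)) + p ^ K * r1 1"
  proof -
    have "exp (ln (?N (\<beta> * p ^ Suc j))) = ?N (\<beta> * p ^ Suc j)" for j using N1[OF bp, of j] by simp
    then show ?thesis by (simp only: ws entropy_integrand_def) simp
  qed
  also have "\<dots> \<le> r1 (entropy_factor p)" using sum_le[of K] R by simp
  finally have le: "r1 (exp ?L) \<le> r1 (entropy_factor p)" .
  have "1 \<le> exp ?L" using p ln0 by (auto intro!: sum_nonneg)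
  then have "exp ?L \<le> entropy_factor p"
    using strict_mono_onD[OF r1_mono, of "entropy_factor p" "exp ?L"] R1 le by (force simp: not_less[symmetric])
  then show "?L \<le> ln (entropy_factor p)" using R1 by (simp add: ln_ge_iff)
qed

lemma countable_sup_tail:
  assumes p: "0 < p" "p < 1" and l: "l > 0" and S: "countable S" "S \<subseteq> B"
  shows "prob {\<omega> \<in> space M. \<exists>t\<in>S. X t \<omega> > x} \<le>
    exp (- (l * x) + ((1 - p) * \<phi> (l * \<gamma> / (1 - p)) + p * \<phi> (l * \<beta> / (1 - p)))) * entropy_factor p"
proof -
  define e where "e j = \<sigma>_inv (\<beta> * p ^ Suc j)" for j
  have e: "0 < e j" "\<sigma> (e j) = \<beta> * p ^ Suc j" for j
    unfolding e_def using \<sigma>_inv[of "\<beta> * p ^ Suc j"] p \<beta>_pos power_Suc_less_one[of p j] by auto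
  have "\<exists>V. finite V \<and> V \<subseteq> B \<and> card V = covering_number B \<rho> (e j) \<and> (\<forall>t\<in>B. \<exists>v\<in>V. \<rho> v t \<le> e j)" for j
    using covering_number_net[OF Metric_space_axioms B_compact e(1)] by metis
  then obtain V where V: "\<And>j. finite (V j)" "\<And>j. V j \<subseteq> B" "\<And>j. card (V j) = covering_number B \<rho> (e j)"
      "\<And>j. \<forall>t\<in>B. \<exists>v\<in>V j. \<rho> v t \<le> e j"
    by metis
  have "prob {\<omega> \<in> space M. \<exists>t\<in>S. X t \<omega> > x} \<le>
    exp (- (l * x) + ((1 - p) * \<phi> (l * \<gamma> / (1 - p)) + p * \<phi> (l * \<beta> / (1 - p)) + ln (entropy_factor p)))"
  proof (rule measure_countable_ex_le[OF finite_measure_axioms S(1)])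
    show "X t \<in> borel_measurable M" if "t \<in> S" for t
      using marginals[of t] that S by (auto simp: mgf_bound_def)
    fix T assume T: "finite T" "T \<subseteq> S"
    show "prob {\<omega> \<in> space M. \<exists>t\<in>T. X t \<omega> > x} \<le>
      exp (- (l * x) + ((1 - p) * \<phi> (l * \<gamma> / (1 - p)) + p * \<phi> (l * \<beta> / (1 - p)) + ln (entropy_factor p)))"
    proof (rule geometric_chaining_tail[OF prob_space_axioms N_fun p l])
      show "finite (V j) \<and> V j \<noteq> {} \<and> V j \<subseteq> B" for j using V B_ne by blast
      show "\<exists>v\<in>V j. mgf_bound M \<phi> (\<beta> * p ^ Suc j) (\<lambda>\<omega>. X t \<omega> - X v \<omega>)" if t: "t \<in> B" for j t
      proof -
        obtain v where v: "v \<in> V j" "\<rho> v t \<le> e j" using V(4) t by blast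
        then have "mgf_bound M \<phi> (\<sigma> (e j)) (\<lambda>\<omega>. X t \<omega> - X v \<omega>)"
          using t V(2) e by (intro increments) (auto simp: commute)
        then show ?thesis using v e by auto
      qed
      show "(\<Sum>j<K. (1 - p) * p ^ j * ln (real (card (V j)))) \<le> ln (entropy_factor p)" for K
        using entropy_factor(2)[OF p, of K] by (simp only: V(3) e_def)
    qed (use T S marginals in auto)
  qed
  also have "\<dots> = exp (- (l * x) + ((1 - p) * \<phi> (l * \<gamma> / (1 - p)) + p * \<phi> (l * \<beta> / (1 - p)))) * entropy_factor p"
    using entropy_factor(1)[OF p] by (simp add: exp_add exp_diff)
  finally show ?thesis .
qed

lemma countable_sup_event:
  assumes S: "countable S" "S \<subseteq> B"
  shows "{\<omega> \<in> space M. \<exists>t\<in>S. X t \<omega> > x} \<in> events"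
proof (rule sets.sets_Collect_countable_Ex'[OF _ S(1)])
  fix t assume "t \<in> S"
  then have [measurable]: "X t \<in> borel_measurable M"
    using marginals[of t] S by (auto simp: mgf_bound_def)
  show "{\<omega> \<in> space M. X t \<omega> > x} \<in> events" by measurable
qed

text \<open>For fixed \<open>l\<close> and \<open>p\<close> the tail bound decays exponentially in \<open>x\<close>.\<close>

lemma AE_countable_bdd_above:
  assumes S: "countable S" "S \<subseteq> B"
  shows "AE \<omega> in M. \<exists>c. \<forall>t\<in>S. X t \<omega> \<le> c"
proof -
  let ?A = "\<lambda>n::nat. {\<omega> \<in> space M. \<exists>t\<in>S. X t \<omega> > real n}"
  let ?b = "(1 - 1/2) * \<phi> (1 * \<gamma> / (1 - 1/2)) + 1/2 * \<phi> (1 * \<beta> / (1 - 1/2))"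
  have ev: "(\<Inter>n. ?A n) \<in> events" using countable_sup_event[OF S] by blast
  have "prob (\<Inter>n. ?A n) \<le> exp (- real n) * (exp ?b * entropy_factor (1/2))" for n
  proof -
    have "prob (\<Inter>n. ?A n) \<le> prob (?A n)"
      by (rule finite_measure_mono) (use countable_sup_event[OF S] in auto)
    also have "\<dots> \<le> exp (- (1 * real n) + ?b) * entropy_factor (1/2)"
      by (rule countable_sup_tail) (use S in auto)
    finally show ?thesis by (simp only: exp_add mult.assoc mult_1)
  qed
  moreover have "(\<lambda>n. exp (- real n) * (exp ?b * entropy_factor (1/2))) \<longlonglongrightarrow> 0 * (exp ?b * entropy_factor (1/2))"
    by (intro tendsto_intros filterlim_compose[OF exp_at_bot])
      (simp add: filterlim_uminus_at_bot filterlim_real_sequentially)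
  ultimately have "prob (\<Inter>n. ?A n) \<le> 0 * (exp ?b * entropy_factor (1/2))"
    by (intro LIMSEQ_le_const) auto
  then have "prob (\<Inter>n. ?A n) = 0" by (simp add: antisym)
  then have "(\<Inter>n. ?A n) \<in> null_sets M" using ev by (simp add: null_sets_def emeasure_eq_measure)
  then have "AE \<omega> in M. \<omega> \<notin> (\<Inter>n. ?A n)" by (rule AE_not_in)
  then show ?thesis
  proof (rule AE_mp, intro AE_I2 impI)
    fix \<omega> assume "\<omega> \<in> space M" "\<omega> \<notin> (\<Inter>n. ?A n)"
    then show "\<exists>c. \<forall>t\<in>S. X t \<omega> \<le> c" by (auto simp: not_less)
  qed
qed

section \<open>Optimising the exponent\<close>

text \<open>The bound \<open>countable_sup_tail\<close> at \<open>l = m * (1 - p)\<close>, with \<open>m\<close> from \<open>power_exponent_optimum\<close>.\<close>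

lemma countable_sup_tail_power:
  assumes \<zeta>: "\<zeta> \<ge> 2" "\<And>t. t > 1 \<Longrightarrow> \<phi> t = t powr \<zeta> / \<zeta>" and \<gamma>: "\<gamma> \<ge> 0"
    and p: "0 < p" "p < 1" and S: "countable S" "S \<subseteq> B"
    and x: "x > (\<gamma> powr \<zeta> * (1 - p) + p * \<beta> powr \<zeta>) / ((1 - p) * (min \<beta> \<gamma>) powr (\<zeta> - 1))"
  shows "prob {\<omega> \<in> space M. \<exists>t\<in>S. X t \<omega> > x} \<le> Z_bound B \<rho> \<sigma> r1 \<zeta> \<gamma> p \<beta> x"
proof (cases "\<gamma> = 0")
  case True
  have "x > 0" using x True \<beta>_pos by simp
  have "AE \<omega> in M. \<forall>t\<in>S. X t \<omega> \<le> 0"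
    unfolding AE_ball_countable[OF S(1)]
    using mgf_bound_zero_imp_AE_le[OF prob_space_axioms] marginals S N_fun True
    by (auto simp: N_function_def)
  then have "AE \<omega> in M. \<not> (\<exists>t\<in>S. X t \<omega> > x)"
    by eventually_elim (use \<open>x > 0\<close> in force)
  then have "prob {\<omega> \<in> space M. \<exists>t\<in>S. X t \<omega> > x} = 0"
    using countable_sup_event[OF S] by (simp add: prob_Collect_eq_0)
  then show ?thesis
    using entropy_factor(1)[OF p] by (simp add: Z_bound_def entropy_factor_def)
next
  case False
  define A where "A = \<gamma> powr \<zeta> * (1 - p) + p * \<beta> powr \<zeta>"
  have A: "A > 0" using p \<beta>_pos False \<gamma> by (auto simp: A_def intro!: add_pos_pos)
  define m where "m = (x * (1 - p) / A) powr (1 / (\<zeta> - 1))"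
  have v: "min \<beta> \<gamma> > 0" using False \<gamma> \<beta>_pos by simp
  have "0 < A / ((1 - p) * (min \<beta> \<gamma>) powr (\<zeta> - 1))" using A p v by (intro divide_pos_pos mult_pos_pos) auto
  then have x0: "x > 0" using x by (simp add: A_def)
  note opt = power_exponent_optimum[of \<zeta> x "1 - p" A, folded m_def]
  have m: "m > 0" using opt(1) \<zeta> x0 A p by simp
  have "m * min \<beta> \<gamma> > 1" using opt(3)[OF _ x0 _ A v] x \<zeta> p by (simp add: A_def)
  moreover have "m * min \<beta> \<gamma> \<le> m * \<beta>" "m * min \<beta> \<gamma> \<le> m * \<gamma>" using m by (simp_all add: mult_left_mono)
  ultimately have *: "\<phi> (m * \<gamma>) = (m * \<gamma>) powr \<zeta> / \<zeta>" "\<phi> (m * \<beta>) = (m * \<beta>) powr \<zeta> / \<zeta>"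
    using \<zeta>(2) by auto
  have "prob {\<omega> \<in> space M. \<exists>t\<in>S. X t \<omega> > x} \<le>
    exp (- (m * (1 - p) * x) + ((1 - p) * \<phi> (m * \<gamma>) + p * \<phi> (m * \<beta>))) * entropy_factor p"
    using countable_sup_tail[OF p _ S, of "m * (1 - p)" x] m p by simp
  also have "(1 - p) * \<phi> (m * \<gamma>) + p * \<phi> (m * \<beta>) = A * m powr \<zeta> / \<zeta>"
    unfolding * using m \<gamma> \<beta>_pos \<zeta>(1) by (simp add: A_def powr_mult field_simps)
  also have "- (m * (1 - p) * x) + A * m powr \<zeta> / \<zeta> =
      (1 - \<zeta>) * (x * (1 - p)) powr (\<zeta> / (\<zeta> - 1)) / (\<zeta> * A powr (1 / (\<zeta> - 1)))"
    using opt(2) \<zeta> x0 A p by simp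
  finally show ?thesis by (simp add: Z_bound_def entropy_factor_def A_def)
qed

end

section \<open>Boundedness and tails of a separable process\<close>

theorem theorem11p2:
  fixes M :: "'w measure"
    and B :: "'b set"
    and \<rho> :: "'b \<Rightarrow> 'b \<Rightarrow> real"
    and X :: "'b \<Rightarrow> 'w \<Rightarrow> real"
    and \<phi> \<sigma> r1 :: "real \<Rightarrow> real"
    and \<zeta> \<beta> \<gamma> :: real
  assumes "prob_space M"
    and "N_function \<phi>" and "condition_Q \<phi>"
    and "\<zeta> \<ge> 2" and "\<And>t. t > 1 \<Longrightarrow> \<phi> t = t powr \<zeta> / \<zeta>"
    and "Metric_space B \<rho>" and "B \<noteq> {}"
    and "separable_space (Metric_space.mtopology B \<rho>)"
    and "compact_space (Metric_space.mtopology B \<rho>)"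
    and "\<And>t. t \<in> B \<Longrightarrow> X t \<in> Sub_phi M \<phi>"
    and "separable_process M B \<rho> X"
    and "continuous_on {0<..} \<sigma>" and "strict_mono_on {0<..} \<sigma>"
    and "(\<sigma> \<longlongrightarrow> 0) (at_right 0)"
    and "\<And>h. h > 0 \<Longrightarrow>
           (SUP (t, s) \<in> {(t, s). t \<in> B \<and> s \<in> B \<and> \<rho> t s \<le> h}.
              ereal (tau_phi M \<phi> (\<lambda>\<omega>. X t \<omega> - X s \<omega>))) \<le> ereal (\<sigma> h)"
    and "(INF s\<in>B. SUP t\<in>B. \<rho> t s) > 0"
    and "\<beta> = \<sigma> (INF s\<in>B. SUP t\<in>B. \<rho> t s)" and "\<beta> > 0"
    and "continuous_on {1..} r1" and "\<And>u. u > 1 \<Longrightarrow> r1 u > 0"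
    and "strict_mono_on {1..} r1"
    and "convex_on {0<..} (\<lambda>t. r1 (exp t))"
    and "set_integrable lborel {0<..<\<beta>} (entropy_integrand B \<rho> \<sigma> r1)"
    and "\<gamma> \<ge> 0" and "\<gamma> powr \<zeta> = (SUP u\<in>B. tau_phi M \<phi> (X u) powr \<zeta>)"
  shows "(AE \<omega> in M. bounded ((\<lambda>t. X t \<omega>) ` B)) \<and>
         (\<forall>p x. 0 < p \<and> p < 1 \<and>
           x > (\<gamma> powr \<zeta> * (1 - p) + p * \<beta> powr \<zeta>) / ((1 - p) * (min \<beta> \<gamma>) powr (\<zeta> - 1)) \<longrightarrow>
           {\<omega> \<in> space M. (SUP t\<in>B. ereal (X t \<omega>)) > ereal x} \<in> sets (completion M) \<and>
           measure (completion M) {\<omega> \<in> space M. (SUP t\<in>B. ereal (X t \<omega>)) > ereal x}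
             \<le> Z_bound B \<rho> \<sigma> r1 \<zeta> \<gamma> p \<beta> x \<and>
           {\<omega> \<in> space M. (INF t\<in>B. ereal (X t \<omega>)) < ereal (- x)} \<in> sets (completion M) \<and>
           measure (completion M) {\<omega> \<in> space M. (INF t\<in>B. ereal (X t \<omega>)) < ereal (- x)}
             \<le> Z_bound B \<rho> \<sigma> r1 \<zeta> \<gamma> p \<beta> x \<and>
           {\<omega> \<in> space M. (SUP t\<in>B. ereal \<bar>X t \<omega>\<bar>) > ereal x} \<in> sets (completion M) \<and>
           measure (completion M) {\<omega> \<in> space M. (SUP t\<in>B. ereal \<bar>X t \<omega>\<bar>) > ereal x}
             \<le> 2 * Z_bound B \<rho> \<sigma> r1 \<zeta> \<gamma> p \<beta> x)"
proof -
  interpret prob_space M by fact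
  interpret Metric_space B \<rho> by fact
  note N = \<open>N_function \<phi>\<close> and compact = \<open>compact_space (Metric_space.mtopology B \<rho>)\<close>
  define r where "r = (INF s\<in>B. SUP t\<in>B. \<rho> t s)"
  have Sub: "\<exists>a>0. mgf_bound M \<phi> a (X t)" if "t \<in> B" for t
    using assms(10)[OF that] by (rule Sub_phi_imp_mgf_bound)
  have tau_diff: "mgf_bound M \<phi> (tau_phi M \<phi> (\<lambda>\<omega>. X t \<omega> - X s \<omega>)) (\<lambda>\<omega>. X t \<omega> - X s \<omega>)"
      "0 \<le> tau_phi M \<phi> (\<lambda>\<omega>. X t \<omega> - X s \<omega>)"
    if ts: "t \<in> B" "s \<in> B" for t s
  proof -
    obtain a b where ab: "a > 0" "b > 0" "mgf_bound M \<phi> a (X t)" "mgf_bound M \<phi> b (X s)"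
      using Sub ts by metis
    have m: "mgf_bound M \<phi> (a + b) (\<lambda>\<omega>. X t \<omega> - X s \<omega>)"
      using mgf_bound_add[OF ab(3) mgf_bound_uminus[OF N ab(4)] ab(1,2)] by simp
    show "mgf_bound M \<phi> (tau_phi M \<phi> (\<lambda>\<omega>. X t \<omega> - X s \<omega>)) (\<lambda>\<omega>. X t \<omega> - X s \<omega>)"
      "0 \<le> tau_phi M \<phi> (\<lambda>\<omega>. X t \<omega> - X s \<omega>)"
      using tau_phi_attained[OF N m] ab by auto
  qed
  have increments: "mgf_bound M \<phi> (\<sigma> h) (\<lambda>\<omega>. X t \<omega> - X s \<omega>)"
    if ts: "t \<in> B" "s \<in> B" "h > 0" "\<rho> t s \<le> h" for t s h
  proof -
    have "ereal (tau_phi M \<phi> (\<lambda>\<omega>. X t \<omega> - X s \<omega>)) \<le>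
        (SUP (t, s) \<in> {(t, s). t \<in> B \<and> s \<in> B \<and> \<rho> t s \<le> h}.
              ereal (tau_phi M \<phi> (\<lambda>\<omega>. X t \<omega> - X s \<omega>)))"
      by (rule SUP_upper2[of "(t, s)"]) (use ts in auto)
    from order_trans[OF this assms(15)[OF ts(3)]]
    have "tau_phi M \<phi> (\<lambda>\<omega>. X t \<omega> - X s \<omega>) \<le> \<sigma> h" by simp
    then show ?thesis by (rule mgf_bound_mono[OF N tau_diff[OF ts(1,2)]])
  qed
  have tau: "mgf_bound M \<phi> (tau_phi M \<phi> (X t)) (X t)" "0 \<le> tau_phi M \<phi> (X t)" if "t \<in> B" for t
  proof -
    obtain a where "a > 0" "mgf_bound M \<phi> a (X t)" using Sub \<open>t \<in> B\<close> by blast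
    then show "mgf_bound M \<phi> (tau_phi M \<phi> (X t)) (X t)" "0 \<le> tau_phi M \<phi> (X t)"
      using tau_phi_attained(1,2)[OF N, of M a "X t"] by auto
  qed
  \<comment> \<open>The real supremum that defines \<open>\<gamma>\<close> is meaningful only for a bounded family of norms; the\<close>
  \<comment> \<open>triangle inequality bounds them by the norm at one point plus \<open>\<sigma>\<close> of the diameter bound.\<close>
  have marginals: "mgf_bound M \<phi> \<gamma> (X u)" if u: "u \<in> B" for u
  proof -
    obtain t0 where t0: "t0 \<in> B" using assms(7) by blast
    have "mbounded B" using compact by (simp add: compact_space_def compactin_imp_mbounded)
    then obtain d where d: "d > 0" "\<And>s t. s \<in> B \<Longrightarrow> t \<in> B \<Longrightarrow> \<rho> s t \<le> d"
      unfolding mbounded_alt_pos by blast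
    obtain a where a: "a > 0" "mgf_bound M \<phi> a (X t0)" using Sub[OF t0] by blast
    define C where "C = a + max (\<sigma> d) 1"
    have C: "tau_phi M \<phi> (X s) \<le> C" if s: "s \<in> B" for s
    proof -
      have "mgf_bound M \<phi> (max (\<sigma> d) 1) (\<lambda>\<omega>. X s \<omega> - X t0 \<omega>)"
      proof (rule mgf_bound_mono[OF N increments[OF s t0 d(1) d(2)[OF s t0]]])
        have "0 < \<sigma> d"
        proof -
          have "0 \<le> \<sigma> (d/2)"
          proof (rule tendsto_upperbound[OF assms(14)])
            show "\<forall>\<^sub>F h in at_right 0. \<sigma> h \<le> \<sigma> (d/2)"
              using eventually_at_right_real[of 0 "d/2"] d(1)
              by (auto elim!: eventually_mono intro!: less_imp_le strict_mono_onD[OF assms(13)])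
          qed simp
          also have "\<dots> < \<sigma> d" using d(1) by (intro strict_mono_onD[OF assms(13)]) auto
          finally show ?thesis .
        qed
        then show "0 \<le> \<sigma> d" by simp
      qed simp
      from mgf_bound_add[OF a(2) this a(1)] have "mgf_bound M \<phi> C (X s)" by (simp add: C_def)
      then show ?thesis using a by (intro tau_phi_attained(3)[OF N]) (auto simp: C_def)
    qed
    have "tau_phi M \<phi> (X u) powr \<zeta> \<le> \<gamma> powr \<zeta>"
      unfolding \<open>\<gamma> powr \<zeta> = _\<close>
    proof (rule cSUP_upper[OF u])
      show "bdd_above ((\<lambda>u. tau_phi M \<phi> (X u) powr \<zeta>) ` B)"
        using C tau assms(4) by (intro bdd_aboveI2[of _ _ "C powr \<zeta>"] powr_mono2) auto
    qed
    then have "tau_phi M \<phi> (X u) \<le> \<gamma>"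
      using powr_less_mono2[of \<zeta> \<gamma> "tau_phi M \<phi> (X u)"] \<open>\<gamma> \<ge> 0\<close> assms(4) by (force simp: not_le[symmetric])
    then show ?thesis by (rule mgf_bound_mono[OF N tau[OF u]])
  qed
  have r: "r > 0" "\<beta> = \<sigma> r" using assms(16,17) by (simp_all only: r_def)
  have pos: "phi_chaining M B \<rho> X \<phi> \<sigma> r1 r \<beta> \<gamma>"
    by (rule phi_chaining.intro[OF assms(1,6) phi_chaining_axioms.intro
          [OF assms(2,7,9,12-14) r assms(18,19,21-23) increments marginals]])
  then have neg: "phi_chaining M B \<rho> (\<lambda>t \<omega>. - X t \<omega>) \<phi> \<sigma> r1 r \<beta> \<gamma>"
    by (rule phi_chaining.phi_chaining_uminus)
  obtain S0 N0 where S: "countable S0" "S0 \<subseteq> B" and N0: "N0 \<in> null_sets M"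
    and sep: "\<forall>G F. openin mtopology G \<longrightarrow> closed F \<longrightarrow>
           {\<omega> \<in> space M. \<forall>t \<in> G \<inter> S0. X t \<omega> \<in> F} - {\<omega> \<in> space M. \<forall>t \<in> G. X t \<omega> \<in> F} \<subseteq> N0"
    using assms(11) unfolding separable_process_def by (elim exE conjE)
  have sepB: "{\<omega> \<in> space M. \<forall>t \<in> S0. X t \<omega> \<in> F} - {\<omega> \<in> space M. \<forall>t \<in> B. X t \<omega> \<in> F} \<subseteq> N0"
    if "closed F" for F
  proof -
    have "openin mtopology B" using openin_topspace[of mtopology] by simp
    from sep[rule_format, OF this that] S(2) show ?thesis by (simp add: Int_absorb1)
  qed
  have transfer: "{\<omega> \<in> space M. \<exists>t\<in>B. X t \<omega> \<notin> F} \<in> sets (completion M) \<and>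
      measure (completion M) {\<omega> \<in> space M. \<exists>t\<in>B. X t \<omega> \<notin> F} = prob {\<omega> \<in> space M. \<exists>t\<in>S0. X t \<omega> \<notin> F}"
    if "closed F" "{\<omega> \<in> space M. \<exists>t\<in>S0. X t \<omega> \<notin> F} \<in> events" for F
    by (rule completion_measure_eqI[OF N0 that(2)]) (use sepB[OF that(1)] S in auto)
  have bounded: "AE \<omega> in M. bounded ((\<lambda>t. X t \<omega>) ` B)"
    using phi_chaining.AE_countable_bdd_above[OF pos S] phi_chaining.AE_countable_bdd_above[OF neg S]
      AE_not_in[OF N0] AE_space
  proof eventually_elim
    case (elim \<omega>)
    then obtain c c' where "\<forall>t\<in>S0. X t \<omega> \<le> c" "\<forall>t\<in>S0. - X t \<omega> \<le> c'" by blast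
    then have "\<forall>t\<in>S0. X t \<omega> \<in> {-c'..c}" by force
    then have "\<forall>t\<in>B. X t \<omega> \<in> {-c'..c}" using sepB[of "{-c'..c}"] elim by auto
    then show ?case by (intro bounded_subset[OF bounded_closed_interval[of "-c'" c]]) auto
  qed
  show ?thesis
  proof (intro conjI bounded allI impI; elim conjE)
    fix p x :: real
    assume p: "0 < p" "p < 1"
      and x: "x > (\<gamma> powr \<zeta> * (1 - p) + p * \<beta> powr \<zeta>) / ((1 - p) * (min \<beta> \<gamma>) powr (\<zeta> - 1))"
    let ?Z = "Z_bound B \<rho> \<sigma> r1 \<zeta> \<gamma> p \<beta> x"
    let ?Up = "{\<omega> \<in> space M. \<exists>t\<in>S0. X t \<omega> > x}" and ?Lo = "{\<omega> \<in> space M. \<exists>t\<in>S0. - X t \<omega> > x}"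
    have up: "?Up \<in> events" "prob ?Up \<le> ?Z"
      by (rule phi_chaining.countable_sup_event[OF pos S]
          phi_chaining.countable_sup_tail_power[OF pos assms(4,5,24) p S x])+
    have lo: "?Lo \<in> events" "prob ?Lo \<le> ?Z"
      by (rule phi_chaining.countable_sup_event[OF neg S]
          phi_chaining.countable_sup_tail_power[OF neg assms(4,5,24) p S x])+
    have "{\<omega> \<in> space M. (SUP t\<in>B. ereal (X t \<omega>)) > ereal x} = {\<omega> \<in> space M. \<exists>t\<in>B. X t \<omega> \<notin> {..x}}"
      by (auto simp: less_SUP_iff not_le)
    moreover have "?Up = {\<omega> \<in> space M. \<exists>t\<in>S0. X t \<omega> \<notin> {..x}}" by (auto simp: not_le)
    ultimately show
      "{\<omega> \<in> space M. (SUP t\<in>B. ereal (X t \<omega>)) > ereal x} \<in> sets (completion M)"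
      "measure (completion M) {\<omega> \<in> space M. (SUP t\<in>B. ereal (X t \<omega>)) > ereal x} \<le> ?Z"
      using transfer[of "{..x}"] up by auto
    have "{\<omega> \<in> space M. (INF t\<in>B. ereal (X t \<omega>)) < ereal (- x)} = {\<omega> \<in> space M. \<exists>t\<in>B. X t \<omega> \<notin> {-x..}}"
      by (auto simp: INF_less_iff not_le)
    moreover have "?Lo = {\<omega> \<in> space M. \<exists>t\<in>S0. X t \<omega> \<notin> {-x..}}" by (auto simp: not_le less_minus_iff)
    ultimately show
      "{\<omega> \<in> space M. (INF t\<in>B. ereal (X t \<omega>)) < ereal (- x)} \<in> sets (completion M)"
      "measure (completion M) {\<omega> \<in> space M. (INF t\<in>B. ereal (X t \<omega>)) < ereal (- x)} \<le> ?Z"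
      using transfer[of "{-x..}"] lo by auto
    have "{\<omega> \<in> space M. (SUP t\<in>B. ereal \<bar>X t \<omega>\<bar>) > ereal x} = {\<omega> \<in> space M. \<exists>t\<in>B. X t \<omega> \<notin> {-x..x}}"
    proof -
      have "x < \<bar>y\<bar> \<longleftrightarrow> y \<notin> {-x..x}" for y :: real by auto
      then show ?thesis by (simp add: less_SUP_iff)
    qed
    moreover have "?Up \<union> ?Lo = {\<omega> \<in> space M. \<exists>t\<in>S0. X t \<omega> \<notin> {-x..x}}"
      by (auto simp: not_le less_minus_iff)
    moreover have "prob (?Up \<union> ?Lo) \<le> 2 * ?Z"
      using measure_Un_le[of ?Up M ?Lo] up lo by linarith
    moreover have "?Up \<union> ?Lo \<in> events" using up lo by blast
    ultimately show
      "{\<omega> \<in> space M. (SUP t\<in>B. ereal \<bar>X t \<omega>\<bar>) > ereal x} \<in> sets (completion M)"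
      "measure (completion M) {\<omega> \<in> space M. (SUP t\<in>B. ereal \<bar>X t \<omega>\<bar>) > ereal x} \<le> 2 * ?Z"
      using transfer[of "{-x..x}"] by auto
  qed
qed

end
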